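(* Let $F$ be an algebraically closed field, let $n\geq 3$ be an integer, and assume $\mathrm{char}(F)=0$ or $\mathrm{char}(F)>n$. Let $W\subseteq M_n(F)$ be an r1-free $F$-subspace of codimension $1$ or $2$. Then $W$ is contained in the subspace of trace zero matrices of $M_n(F)$. Furthermore, if $n\geq 4$, then for each integer $d$ with $3\leq d<n$ there exists an r1-free subspace of $M_n(F)$ of codimension $d$ that is not contained in the subspace of trace zero matrices.
   Context: $M_n(F)$ is the algebra of $n\times n$ matrices over $F$. An $F$-subspace $W\subseteq M_n(F)$ is called r1-free if it does not contain any rank $1$ idempotent matrix. *)

theory Defs
  imports "HOL-Analysis.Analysis"
begin

text \<open>
  The library's \<open>(*s)\<close> only makes \<open>'a ^ 'n\<close> an \<open>'a\<close>-vector space; on \<open>'a ^ 'n ^ 'n\<close> it would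
  have row vectors as scalars, so matrices get their own scalar multiplication.
\<close>

definition mat_scale :: "'a::field \<Rightarrow> 'a ^ 'n ^ 'n \<Rightarrow> 'a ^ 'n ^ 'n"
  where "mat_scale c A = (\<chi> i j. c * A $ i $ j)"

definition mat_unit :: "'n \<Rightarrow> 'n \<Rightarrow> 'a::field ^ 'n ^ 'n"
  where "mat_unit k l = (\<chi> i j. if i = k \<and> j = l then 1 else 0)"

definition mat_units :: "('a::field ^ 'n ^ 'n) set"
  where "mat_units = range (\<lambda>(k, l). mat_unit k l)"

interpretation mat_vs: vector_space mat_scale
  by unfold_locales (simp_all add: mat_scale_def vec_eq_iff algebra_simps)

lemma mat_unit_sum_nth:
  "(\<Sum>p\<in>UNIV. mat_scale (f p) (case p of (k, l) \<Rightarrow> mat_unit k l)) $ i $ j = (f (i, j) :: 'a::field)"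
proof -
  have "(\<Sum>p\<in>UNIV. mat_scale (f p) (case p of (k, l) \<Rightarrow> mat_unit k l)) $ i $ j
      = (\<Sum>p\<in>UNIV. if p = (i, j) then f p else 0)"
    unfolding sum_component
    by (rule sum.cong) (auto simp: mat_scale_def mat_unit_def split: prod.splits)
  then show ?thesis by simp
qed

lemma inj_mat_unit: "inj (\<lambda>(k, l). mat_unit k l :: 'a::field ^ 'n ^ 'n)"
proof (rule injI, clarify)
  fix a b c d :: 'n
  assume "mat_unit a b = (mat_unit c d :: 'a ^ 'n ^ 'n)"
  then have "mat_unit a b $ a $ b = (mat_unit c d $ a $ b :: 'a)" by simp
  then show "a = c \<and> b = d" by (simp add: mat_unit_def split: if_splits)
qed

interpretation mat_vs: finite_dimensional_vector_space mat_scale mat_units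
proof
  show "finite (mat_units :: ('a ^ 'n ^ 'n) set)"
    by (simp add: mat_units_def)
  show "mat_vs.independent (mat_units :: ('a ^ 'n ^ 'n) set)"
    unfolding mat_units_def
  proof (rule mat_vs.independent_if_scalars_zero)
    fix f :: "'a ^ 'n ^ 'n \<Rightarrow> 'a" and x
    let ?u = "\<lambda>(k, l). mat_unit k l :: 'a ^ 'n ^ 'n"
    assume "(\<Sum>x\<in>range ?u. mat_scale (f x) x) = 0" and x: "x \<in> range ?u"
    then have eq: "(\<Sum>p\<in>UNIV. mat_scale (f (?u p)) (?u p)) = 0"
      by (simp add: sum.reindex[OF inj_mat_unit])
    obtain k l where kl: "x = ?u (k, l)" using x by force
    have "f (?u (k, l)) = 0"
      using eq mat_unit_sum_nth[of "\<lambda>p. f (?u p)" k l] by simp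
    then show "f x = 0" using kl by simp
  qed simp
  show "mat_vs.span (mat_units :: ('a ^ 'n ^ 'n) set) = UNIV"
  proof -
    have "A \<in> mat_vs.span mat_units" for A :: "'a ^ 'n ^ 'n"
    proof -
      have "A = (\<Sum>p\<in>UNIV. mat_scale (A $ fst p $ snd p) (case p of (k, l) \<Rightarrow> mat_unit k l))"
        by (simp add: vec_eq_iff mat_unit_sum_nth del: sum_component)
      also have "\<dots> \<in> mat_vs.span mat_units"
        by (intro mat_vs.span_sum mat_vs.span_scale mat_vs.span_base)
           (auto simp: mat_units_def)
      finally show ?thesis .
    qed
    then show ?thesis by auto
  qed
qed

lemma dim_mat_UNIV: "mat_vs.dim (UNIV :: ('a::field ^ 'n ^ 'n) set) = CARD('n)\<^sup>2"
proof -
  have "mat_vs.dim (UNIV :: ('a ^ 'n ^ 'n) set) = card (mat_units :: ('a ^ 'n ^ 'n) set)"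
    by (rule mat_vs.dim_UNIV)
  also have "\<dots> = CARD('n)\<^sup>2"
    by (simp add: mat_units_def card_image[OF inj_mat_unit] power2_eq_square)
  finally show ?thesis .
qed

definition mat_codim :: "('a::field ^ 'n ^ 'n) set \<Rightarrow> nat"
  where "mat_codim W = mat_vs.dim (UNIV :: ('a ^ 'n ^ 'n) set) - mat_vs.dim W"

text \<open>Over a general field, \<^const>\<open>rank\<close> is the dimension of the row space.\<close>

definition r1_free :: "('a::field ^ 'n ^ 'n) set \<Rightarrow> bool"
  where "r1_free W \<longleftrightarrow> \<not> (\<exists>A\<in>W. rank A = 1 \<and> A ** A = A)"

end

theory Submission
  imports Defs
begin

text \<open>
  A rank one idempotent is a product \<open>x y\<^sup>T\<close> with \<open>y\<^sup>T x = 1\<close>, and \<open>tr (x y\<^sup>T B) = y\<^sup>T B x\<close>.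
  A subspace \<open>W\<close> of codimension \<open>1\<close> or \<open>2\<close> has the form \<open>{A. tr (A B) = tr (A C) = 0}\<close>.
  Hence if \<open>W\<close> is r1-free, then for no \<open>x\<close> is there a covector \<open>y\<close> with value \<open>1\<close> at \<open>x\<close> that
  annihilates \<open>B x\<close> and \<open>C x\<close>; in other words, every vector \<open>x\<close> lies in the span of \<open>B x\<close> and \<open>C x\<close>
  (\<open>r1_free_imp_in_span\<close>). On the other hand, the trace vanishes on \<open>W\<close> as soon as the identity matrix
  is a linear combination of \<open>B\<close> and \<open>C\<close>. So the first half of the theorem is an interchange of
  quantifiers (\<open>identity_in_span_of_two\<close>): if \<open>x = s (B x) + t (C x)\<close> is solvable for each \<open>x\<close>, then
  one pair of scalars serves all \<open>x\<close>.
  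
  For this, choose a singular member \<open>g\<close> of the pencil of \<open>B\<close> and \<open>C\<close> and a kernel vector \<open>x0\<close> of it.
  The hypothesis at \<open>x0\<close> makes \<open>x0\<close> an eigenvector, with nonzero eigenvalue, of a second member of
  the pencil, which is rescaled to a map \<open>f\<close> with \<open>f x0 = x0\<close>. Feeding \<open>x0 + t v\<close> into the
  hypothesis and varying \<open>t\<close> shows that \<open>f v - v\<close> and \<open>g v\<close> are dependent modulo \<open>x0\<close>, for every \<open>v\<close>
  (\<open>dependent_mod_kernel_vector\<close>). Two linear maps that are pointwise dependent are dependent, or both
  map into one line (\<open>pointwise_parallel_cases\<close>). So either a combination of \<open>f - 1\<close> and \<open>g\<close> maps
  into the line of \<open>x0\<close>, or both map into a plane. In each case further uses of the same dichotomy
  give the result directly or reduce to the situation where \<open>f\<close> and \<open>g\<close> are both scalar modulo a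
  common line, which is elementary linear algebra (\<open>identity_in_span_mod_line\<close>). Dimension at least
  \<open>3\<close> enters because a plane cannot contain all vectors.
  
  For the second half, fix indices \<open>i \<noteq> j\<close> and impose \<open>A\<^sub>i\<^sub>i = 0\<close>, \<open>A\<^sub>i\<^sub>j + A\<^sub>j\<^sub>i = 0\<close> and
  \<open>tr A + A\<^sub>j\<^sub>i = 0\<close>. In rank one, \<open>A\<^sub>i\<^sub>j A\<^sub>j\<^sub>i = A\<^sub>i\<^sub>i A\<^sub>j\<^sub>j = 0\<close>, so the second condition gives \<open>A\<^sub>j\<^sub>i = 0\<close>
  and the third \<open>tr A = 0\<close>, whereas a rank one idempotent has trace \<open>1\<close>. These three conditions leave
  matrices of nonzero trace, and cutting down to a smaller subspace that retains one of them yields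
  every larger codimension.
\<close>

section \<open>Linear maps, separation and projections\<close>

lemma linear_vecD:
  fixes f :: "'a::field ^ 'n \<Rightarrow> 'a ^ 'm"
  assumes "Vector_Spaces.linear (*s) (*s) f"
  shows "f (x + y) = f x + f y" "f (x - y) = f x - f y" "f (c *s x) = c *s f x" "f 0 = 0"
  using assms by (rule vec.linear_add vec.linear_diff vec.linear_scale vec.linear_0)+

lemma linear_combI:
  fixes f g :: "'a::field ^ 'n \<Rightarrow> 'a ^ 'm"
  assumes "Vector_Spaces.linear (*s) (*s) f" "Vector_Spaces.linear (*s) (*s) g"
  shows "Vector_Spaces.linear (*s) (*s) (\<lambda>x. a *s f x + b *s g x)"
  by (intro vec.linear_compose_add vec.linear_compose_scale_right assms)

lemma linear_comp:
  fixes f :: "'a::field ^ 'n \<Rightarrow> 'a ^ 'm" and g :: "'a ^ 'm \<Rightarrow> 'a ^ 'k"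
  assumes "Vector_Spaces.linear (*s) (*s) f" "Vector_Spaces.linear (*s) (*s) g"
  shows "Vector_Spaces.linear (*s) (*s) (\<lambda>x. g (f x))"
  using Vector_Spaces.linear_compose[OF assms] by (simp add: o_def)

lemma span_singletonE:
  fixes v r :: "'a::field ^ 'n"
  assumes "v \<in> vec.span {r}" obtains c where "v = c *s r"
  using assms by (auto simp: vec.span_singleton)

lemma exists_notin_span:
  fixes S :: "('a::field ^ 'n) set"
  assumes "finite S" "card S < CARD('n)"
  obtains z where "z \<notin> vec.span S"
proof -
  have "vec.dim S \<le> card S" using assms(1) by (rule vec.dim_le_card')
  then have "vec.dim (vec.span S) \<noteq> vec.dim (UNIV :: ('a^'n) set)"
    using assms(2) by (simp only: vec.dim_span vec_dim_card)
  then have "vec.span S \<noteq> UNIV" by metis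
  then show thesis using that by blast
qed

lemma exists_notin_plane:
  fixes a b :: "'a::field ^ 'n"
  assumes "CARD('n) \<ge> 3"
  obtains z where "z \<notin> vec.span {a, b}"
proof (rule exists_notin_span)
  show "card {a, b} < CARD('n)"
    using assms card_insert_le_m1[of 2 "{b}" a] by simp
qed simp

text \<open>
  The covector is the coordinate along \<open>x\<close> in a basis that extends \<open>x\<close> together with a basis of the
  span of \<open>S\<close>; its entries are the values of that coordinate at the standard basis.
\<close>

lemma separating_covector:
  fixes x :: "'a::field ^ 'n"
  assumes "x \<notin> vec.span S"
  obtains y where "(\<Sum>i\<in>UNIV. y $ i * x $ i) = 1" "\<And>v. v \<in> S \<Longrightarrow> (\<Sum>i\<in>UNIV. y $ i * v $ i) = 0"
proof -
  obtain B where B: "B \<subseteq> S" "vec.independent B" "S \<subseteq> vec.span B"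
    by (rule vec.maximal_independent_subset)
  have x: "x \<notin> vec.span B" using assms vec.span_mono[OF B(1)] by blast
  then have ind: "vec.independent (insert x B)" using B(2) by (rule vec.independent_insertI)
  let ?T = "vec.extend_basis (insert x B)"
  have T: "insert x B \<subseteq> ?T" "vec.independent ?T" "vec.span ?T = UNIV"
    using vec.extend_basis_superset[OF ind] vec.independent_extend_basis[OF ind]
      vec.span_extend_basis[OF ind] by blast+
  define h where "h v = vec.representation ?T v x" for v
  interpret h: Vector_Spaces.linear "(*s)" "(*)" h
    unfolding h_def by (rule vec.linear_representation[OF T(2,3)])
  have expand: "h v = (\<Sum>i\<in>UNIV. (\<chi> i. h (axis i 1)) $ i * v $ i)" for v
  proof -
    have "h v = h (\<Sum>i\<in>UNIV. v $ i *s axis i 1)" by (simp add: basis_expansion)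
    also have "\<dots> = (\<Sum>i\<in>UNIV. v $ i * h (axis i 1))" by (simp add: h.sum h.scale)
    finally show ?thesis by (simp add: mult.commute)
  qed
  show thesis
  proof (rule that)
    have "h x = 1" using T(1) by (simp add: h_def vec.representation_basis[OF T(2)])
    then show "(\<Sum>i\<in>UNIV. (\<chi> i. h (axis i 1)) $ i * x $ i) = 1" by (rule trans[OF expand[symmetric]])
  next
    fix v assume "v \<in> S"
    then have "vec.representation ?T v = vec.representation B v"
      using B(3) T(1) by (intro vec.representation_extend[OF T(2)]) auto
    moreover have "x \<notin> B" using x vec.span_base by blast
    ultimately have "h v = 0" unfolding h_def using vec.representation_ne_zero by metis
    then show "(\<Sum>i\<in>UNIV. (\<chi> i. h (axis i 1)) $ i * v $ i) = 0" by (rule trans[OF expand[symmetric]])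
  qed
qed

text \<open>
  A vector-valued form of the separation: all rows of the matrix are the separating covector. Such a
  map serves below to describe complements of hyperplanes.
\<close>

lemma linear_map_separating:
  fixes z :: "'a::field ^ 'n"
  assumes "z \<notin> vec.span S"
  obtains e :: "'a ^ 'n \<Rightarrow> 'a ^ 'n" where "Vector_Spaces.linear (*s) (*s) e"
    and "\<And>v. v \<in> vec.span S \<Longrightarrow> e v = 0" and "e z \<noteq> 0"
proof -
  obtain y where y: "(\<Sum>i\<in>UNIV. y $ i * z $ i) = 1"
    "\<And>v. v \<in> S \<Longrightarrow> (\<Sum>i\<in>UNIV. y $ i * v $ i) = 0"
    using separating_covector[OF assms] by blast
  let ?e = "(*v) ((\<chi> i. y) :: 'a ^ 'n ^ 'n)"
  have e: "(?e v) $ i = (\<Sum>j\<in>UNIV. y $ j * v $ j)" for v i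
    by (simp only: matrix_vector_mult_def vec_lambda_beta)
  show thesis
  proof (rule that[OF matrix_vector_mul_linear_gen])
    fix v assume "v \<in> vec.span S"
    then show "?e v = 0"
    proof (rule vec.linear_eq_0_on_span[OF matrix_vector_mul_linear_gen, rotated])
      fix w assume "w \<in> S"
      show "?e w = 0"
        unfolding vec_eq_iff e y(2)[OF \<open>w \<in> S\<close>] by (simp only: zero_index simp_thms)
    qed
  next
    show "?e z \<noteq> 0" unfolding vec_eq_iff e y(1) by (simp only: zero_index one_neq_zero simp_thms)
  qed
qed

text \<open>
  The map \<open>q\<close> serves as a concrete substitute for the quotient by the line of \<open>x0\<close>: it has exactly
  this line as its kernel, but takes values in the original space. For \<open>x0 = 0\<close> it is the identity.
\<close>

lemma projection_along:
  fixes x0 :: "'a::field ^ 'n"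
  obtains q :: "'a ^ 'n \<Rightarrow> 'a ^ 'n" where "Vector_Spaces.linear (*s) (*s) q"
    and "\<And>v. v - q v \<in> vec.span {x0}" and "q x0 = 0"
proof (cases "x0 = 0")
  case True
  then show thesis using that[of id] vec.linear_id by (simp add: vec.span_zero)
next
  case False
  then obtain k where k: "x0 $ k \<noteq> 0" by (auto simp: vec_eq_iff)
  define q where "q v = v - (v $ k / x0 $ k) *s x0" for v
  have "Vector_Spaces.linear (*s) (*s) q"
    unfolding Vector_Spaces.linear_iff q_def
    by (simp add: vec.vector_space_axioms vec_eq_iff add_divide_distrib algebra_simps)
  moreover have "v - q v \<in> vec.span {x0}" for v
    by (simp add: q_def vec.span_scale vec.span_base)
  moreover have "q x0 = 0" using k by (simp add: q_def)
  ultimately show thesis by (rule that)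
qed

section \<open>Pointwise dependent linear maps\<close>

text \<open>
  Linear dependence of two vectors, expressed by the vanishing of all two-by-two minors. Being a
  polynomial condition, it passes from a dense set to the whole space.
\<close>

definition parallel :: "'a::field ^ 'n \<Rightarrow> 'a ^ 'n \<Rightarrow> bool"
  where "parallel u w \<longleftrightarrow> (\<forall>i j. u $ i * w $ j = u $ j * w $ i)"

lemma parallel_imp_multiple:
  fixes u w :: "'a::field ^ 'n"
  assumes "parallel u w" and "w \<noteq> 0"
  obtains c where "u = c *s w"
proof -
  obtain k where k: "w $ k \<noteq> 0" using \<open>w \<noteq> 0\<close> by (auto simp: vec_eq_iff)
  have "u = (u $ k / w $ k) *s w"
    using assms(1) k by (simp add: vec_eq_iff parallel_def divide_simps)
  then show thesis by (rule that)
qed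

lemma parallel_iff_dependent:
  fixes u w :: "'a::field ^ 'n"
  shows "parallel u w \<longleftrightarrow> (\<exists>\<alpha> \<beta>. (\<alpha> \<noteq> 0 \<or> \<beta> \<noteq> 0) \<and> \<alpha> *s u + \<beta> *s w = 0)"
proof
  assume par: "parallel u w"
  show "\<exists>\<alpha> \<beta>. (\<alpha> \<noteq> 0 \<or> \<beta> \<noteq> 0) \<and> \<alpha> *s u + \<beta> *s w = 0"
  proof (cases "w = 0")
    case True
    then have "0 *s u + 1 *s w = 0" by simp
    then show ?thesis by (metis zero_neq_one)
  next
    case False
    then obtain c where "u = c *s w" using parallel_imp_multiple[OF par] by blast
    then have "1 *s u + (- c) *s w = 0" by (simp add: vec_eq_iff)
    then show ?thesis by (metis zero_neq_one)
  qed
next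
  assume "\<exists>\<alpha> \<beta>. (\<alpha> \<noteq> 0 \<or> \<beta> \<noteq> 0) \<and> \<alpha> *s u + \<beta> *s w = 0"
  then obtain \<alpha> \<beta> where nz: "\<alpha> \<noteq> 0 \<or> \<beta> \<noteq> 0" and "\<alpha> *s u + \<beta> *s w = 0" by blast
  then have rel: "\<alpha> * u $ i + \<beta> * w $ i = 0" for i by (simp add: vec_eq_iff)
  have "u $ i * w $ j = u $ j * w $ i" for i j
  proof -
    have "\<alpha> * (u $ i * w $ j - u $ j * w $ i) = 0"
         "\<beta> * (u $ i * w $ j - u $ j * w $ i) = 0"
      using rel[of i] rel[of j] by algebra+
    with nz show ?thesis by auto
  qed
  then show "parallel u w" by (simp add: parallel_def)
qed

lemma parallel_commute: "parallel u w \<Longrightarrow> parallel w u"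
  by (simp add: parallel_def mult.commute)

text \<open>
  Choose \<open>u\<close> with \<open>g u \<noteq> 0\<close> and subtract the multiple of \<open>g\<close> from \<open>f\<close> that makes the difference \<open>h\<close>
  vanish at \<open>u\<close>. Since \<open>h (v + u) = h v\<close> is parallel to both \<open>g v\<close> and \<open>g v + g u\<close>, it is parallel
  to \<open>g u\<close>. Thus \<open>h\<close> maps into the line of \<open>g u\<close>, and if \<open>h \<noteq> 0\<close>, this line captures \<open>g\<close> as well.
\<close>

lemma pointwise_parallel_cases:
  fixes f g :: "'a::field ^ 'n \<Rightarrow> 'a ^ 'm"
  assumes f: "Vector_Spaces.linear (*s) (*s) f" and g: "Vector_Spaces.linear (*s) (*s) g"
    and par: "\<And>v. parallel (f v) (g v)"
  obtains (dependent) \<alpha> \<beta> where "\<alpha> \<noteq> 0 \<or> \<beta> \<noteq> 0" "\<And>v. \<alpha> *s f v + \<beta> *s g v = 0"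
    | (common_line) p where "\<And>v. f v \<in> vec.span {p}" "\<And>v. g v \<in> vec.span {p}"
proof (cases "\<forall>v. g v = 0")
  case True
  then show thesis using dependent[of 0 1] by simp
next
  case False
  then obtain u where u: "g u \<noteq> 0" by blast
  obtain l where l: "f u = l *s g u" using parallel_imp_multiple[OF par u] by blast
  define h where "h v = f v - l *s g v" for v
  have h_add: "h (v + w) = h v + h w" for v w
    by (simp add: h_def linear_vecD[OF f] linear_vecD[OF g] vec_eq_iff algebra_simps)
  have hu: "h u = 0" by (simp add: h_def l)
  have par_h: "parallel (h v) (g v)" for v
    using par[of v] by (simp add: h_def parallel_def algebra_simps)
  have h_line: "h v \<in> vec.span {g u}" for v
  proof (cases "h v = 0")
    case hv: False
    obtain c where c: "g v = c *s h v"
      using parallel_imp_multiple[OF parallel_commute[OF par_h] hv] by blast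
    have "h (v + u) \<noteq> 0" using hv by (simp add: h_add hu)
    then obtain d where d: "g (v + u) = d *s h (v + u)"
      using parallel_imp_multiple[OF parallel_commute[OF par_h]] by blast
    have gu: "g u = (d - c) *s h v"
      using c d by (simp add: h_add hu linear_vecD[OF g] vec_eq_iff algebra_simps)
    then have "d \<noteq> c" using u by auto
    then have "h v = (1 / (d - c)) *s g u" by (simp add: gu vec_eq_iff divide_simps) (simp add: algebra_simps)
    then show ?thesis by (metis vec.span_base vec.span_scale singletonI)
  qed (simp add: vec.span_zero)
  show thesis
  proof (cases "\<forall>v. h v = 0")
    case True
    then show thesis using dependent[of 1 "- l"] by (simp add: h_def)
  next
    case False
    then obtain w where w: "h w \<noteq> 0" by blast
    have g_line_if: "g v \<in> vec.span {g u}" if hv: "h v \<noteq> 0" for v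
    proof -
      obtain c where "g v = c *s h v"
        using parallel_imp_multiple[OF parallel_commute[OF par_h] hv] by blast
      then show ?thesis using h_line[of v] by (simp add: vec.span_scale)
    qed
    \<comment> \<open>where \<open>h\<close> vanishes, translate by a vector \<open>w\<close> with \<open>h w \<noteq> 0\<close>\<close>
    have g_line: "g v \<in> vec.span {g u}" for v
    proof (cases "h v = 0")
      case True
      then have "g (v + w) \<in> vec.span {g u}" using w by (intro g_line_if) (simp add: h_add)
      then have "g (v + w) - g w \<in> vec.span {g u}" using g_line_if[OF w] by (rule vec.span_diff)
      then show ?thesis by (simp add: linear_vecD[OF g])
    qed (rule g_line_if)
    have "f v \<in> vec.span {g u}" for v
    proof -
      have "f v = h v + l *s g v" by (simp add: h_def)
      then show ?thesis using h_line[of v] g_line[of v] by (simp add: vec.span_add vec.span_scale)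
    qed
    then show thesis using g_line by (rule common_line)
  qed
qed

text \<open>
  The polynomial \<open>1 + X p\<close> takes the value \<open>1\<close> everywhere, so it has no root and is constant. This
  replaces an appeal to the infinitude of the field.
\<close>

lemma alg_closed_poly_zero_at_0:
  fixes p :: "'a::alg_closed_field poly"
  assumes zero: "\<And>t. t \<noteq> 0 \<Longrightarrow> poly p t = 0"
  shows "poly p 0 = 0"
proof -
  have "degree (pCons 1 p) = 0"
  proof (rule ccontr)
    assume "degree (pCons 1 p) \<noteq> 0"
    then obtain x where "poly (pCons 1 p) x = 0"
      using alg_closed_imp_poly_has_root by blast
    then show False using zero[of x] by (cases "x = 0") auto
  qed
  then show ?thesis by (simp split: if_splits)
qed

text \<open>
  On the line \<open>v + t u\<close> through a point of the kernel of \<open>e\<close>, the minors are polynomials in \<open>t\<close>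
  that vanish for all \<open>t \<noteq> 0\<close>, hence also at \<open>t = 0\<close>.
\<close>

lemma parallel_off_hyperplane:
  fixes f g :: "'a::alg_closed_field ^ 'n \<Rightarrow> 'a ^ 'm"
  assumes f: "Vector_Spaces.linear (*s) (*s) f" and g: "Vector_Spaces.linear (*s) (*s) g"
    and e: "Vector_Spaces.linear (*s) (*s) (e :: 'a ^ 'n \<Rightarrow> 'a ^ 'k)" and "e u \<noteq> 0"
    and par: "\<And>v. e v \<noteq> 0 \<Longrightarrow> parallel (f v) (g v)"
  shows "parallel (f v) (g v)"
proof (cases "e v = 0")
  case True
  show ?thesis unfolding parallel_def
  proof (intro allI)
    fix i j
    define p where "p = [:f v $ i, f u $ i:] * [:g v $ j, g u $ j:]
                      - [:f v $ j, f u $ j:] * [:g v $ i, g u $ i:]"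
    have "poly p t = 0" if "t \<noteq> 0" for t
    proof -
      have "e (v + t *s u) \<noteq> 0"
        using True that \<open>e u \<noteq> 0\<close> by (simp add: linear_vecD[OF e])
      from par[OF this] have "(f v $ i + t * f u $ i) * (g v $ j + t * g u $ j)
          = (f v $ j + t * f u $ j) * (g v $ i + t * g u $ i)"
        by (simp add: parallel_def linear_vecD[OF f] linear_vecD[OF g])
      then show ?thesis by (simp only: p_def poly_diff poly_mult poly_pCons poly_0) algebra
    qed
    then have "poly p 0 = 0" by (rule alg_closed_poly_zero_at_0)
    then show "f v $ i * g v $ j = f v $ j * g v $ i" by (simp add: p_def mult.commute)
  qed
qed (rule par)

section \<open>From pointwise to uniform coefficients\<close>

text \<open>
  An endomorphism for which, modulo a line, almost every vector is an eigenvector is a scalar modulo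
  that line. This is the dichotomy for pointwise dependent maps, applied to the identity and \<open>A\<close>
  followed by the projection along \<open>x0\<close>; the alternative of a common line would place the whole
  space into a plane.
\<close>

lemma scalar_mod_line:
  fixes A :: "'a::alg_closed_field ^ 'n \<Rightarrow> 'a ^ 'n"
  assumes n: "CARD('n) \<ge> 3"
    and A: "Vector_Spaces.linear (*s) (*s) A"
    and e: "Vector_Spaces.linear (*s) (*s) (e :: 'a ^ 'n \<Rightarrow> 'a ^ 'k)" and u: "e u \<noteq> 0"
    and dep: "\<And>v. e v \<noteq> 0 \<Longrightarrow>
      \<exists>\<alpha> \<beta>. (\<alpha> \<noteq> 0 \<or> \<beta> \<noteq> 0) \<and> \<alpha> *s v + \<beta> *s A v \<in> vec.span {x0}"
  obtains l where "\<And>v. A v - l *s v \<in> vec.span {x0}"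
proof -
  obtain q :: "'a ^ 'n \<Rightarrow> 'a ^ 'n" where q: "Vector_Spaces.linear (*s) (*s) q"
    and vq: "\<And>v. v - q v \<in> vec.span {x0}" and qx0: "q x0 = 0"
    using projection_along[of x0] by metis
  have q0: "q v = 0" if "v \<in> vec.span {x0}" for v
    using that by (auto elim!: span_singletonE simp: linear_vecD[OF q] qx0)
  have par: "parallel (q v) (q (A v))" for v
  proof (rule parallel_off_hyperplane[OF q linear_comp[OF A q] e u])
    fix v assume "e v \<noteq> 0"
    then obtain \<alpha> \<beta> where "\<alpha> \<noteq> 0 \<or> \<beta> \<noteq> 0" and "\<alpha> *s v + \<beta> *s A v \<in> vec.span {x0}"
      using dep by blast
    then have "\<alpha> *s q v + \<beta> *s q (A v) = 0"
      using q0[of "\<alpha> *s v + \<beta> *s A v"] by (simp add: linear_vecD[OF q])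
    then show "parallel (q v) (q (A v))"
      using \<open>\<alpha> \<noteq> 0 \<or> \<beta> \<noteq> 0\<close> by (auto simp: parallel_iff_dependent)
  qed
  show thesis
  proof (rule pointwise_parallel_cases[OF q linear_comp[OF A q] par])
    fix \<alpha> \<beta> assume nz: "\<alpha> \<noteq> 0 \<or> \<beta> \<noteq> 0" and "\<And>v. \<alpha> *s q v + \<beta> *s q (A v) = 0"
    then have "q (\<alpha> *s v + \<beta> *s A v) = 0" for v by (simp add: linear_vecD[OF q])
    then have mem: "\<alpha> *s v + \<beta> *s A v \<in> vec.span {x0}" for v
      using vq[of "\<alpha> *s v + \<beta> *s A v"] by simp
    have "\<beta> \<noteq> 0"
    proof
      assume "\<beta> = 0"
      then have "(1/\<alpha>) *s (\<alpha> *s v + \<beta> *s A v) = v" for v using nz by simp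
      then have "v \<in> vec.span {x0}" for v using mem[of v] by (metis vec.span_scale)
      then show False using exists_notin_plane[OF n, of x0 x0] by auto
    qed
    then have "A v - (- \<alpha> / \<beta>) *s v = (1 / \<beta>) *s (\<alpha> *s v + \<beta> *s A v)" for v
      by (simp add: vec_eq_iff divide_simps)
    then show thesis using mem by (metis that vec.span_scale)
  next
    fix p assume "\<And>v. q v \<in> vec.span {p}"
    then have "(v - q v) + q v \<in> vec.span {x0, p}" for v
      using vq[of v] vec.span_mono[of "{x0}" "{x0, p}"] vec.span_mono[of "{p}" "{x0, p}"]
      by (intro vec.span_add) auto
    then have "v \<in> vec.span {x0, p}" for v by simp
    then show thesis using exists_notin_plane[OF n, of x0 p] by auto
  qed
qed

lemma proportional_on_line:
  fixes N E :: "'a::field ^ 'n \<Rightarrow> 'a ^ 'm"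
  assumes N: "Vector_Spaces.linear (*s) (*s) N" and E: "Vector_Spaces.linear (*s) (*s) E"
    and N_line: "\<And>v. N v \<in> vec.span {r}" and E_line: "\<And>v. E v \<in> vec.span {r}"
    and ker: "\<And>v. E v = 0 \<Longrightarrow> N v = 0"
  obtains k where "\<And>v. N v = k *s E v"
proof (cases "\<forall>v. E v = 0")
  case True
  then show thesis using that[of 0] ker by simp
next
  case False
  then obtain w where w: "E w \<noteq> 0" by blast
  then obtain e where e: "E w = e *s r" "e \<noteq> 0"
    using E_line[of w] by (auto elim: span_singletonE)
  obtain m where m: "N w = m *s r" using N_line by (rule span_singletonE)
  have "N v = (m / e) *s E v" for v
  proof -
    obtain d where d: "E v = d *s r" using E_line by (rule span_singletonE)
    have "E (v - (d / e) *s w) = 0" using e d by (simp add: linear_vecD[OF E])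
    then have "N v - (d / e) *s N w = 0" using ker by (metis linear_vecD(2,3)[OF N])
    then show ?thesis by (simp add: m d vec_eq_iff)
  qed
  then show thesis by (rule that)
qed

text \<open>
  Put \<open>N = f - b\<close> and \<open>M = g - c\<close>, which map into the line of \<open>r\<close>. For \<open>v\<close> off this line, comparing
  the components of \<open>v = s (f v) + t (g v)\<close> gives \<open>s b + t c = 1\<close> and \<open>s N v + t M v = 0\<close>. If also
  \<open>E v = c N v - b M v = 0\<close>, these relations force \<open>N v = M v = 0\<close>. So \<open>N\<close> and \<open>M\<close> vanish on the
  kernel of \<open>E = c f - b g\<close>, and as all three have values in a line, \<open>N\<close> and \<open>M\<close> are multiples of
  \<open>E\<close>. Then \<open>b = f - N\<close> and \<open>c = g - M\<close> are combinations of \<open>f\<close> and \<open>g\<close>, and so is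
  \<open>1 = s b + t c\<close>.
\<close>

lemma identity_in_span_mod_line:
  fixes f g :: "'a::field ^ 'n \<Rightarrow> 'a ^ 'n"
  assumes n: "CARD('n) \<ge> 3"
    and f: "Vector_Spaces.linear (*s) (*s) f" and g: "Vector_Spaces.linear (*s) (*s) g"
    and H: "\<And>v. \<exists>s t. v = s *s f v + t *s g v"
    and fb: "\<And>v. f v - b *s v \<in> vec.span {r}" and gc: "\<And>v. g v - c *s v \<in> vec.span {r}"
  shows "\<exists>s t. \<forall>v. v = s *s f v + t *s g v"
proof -
  define N where "N v = f v - b *s v" for v
  define M where "M v = g v - c *s v" for v
  define E where "E v = c *s N v - b *s M v" for v
  have NME: "Vector_Spaces.linear (*s) (*s) N" "Vector_Spaces.linear (*s) (*s) M"
      "Vector_Spaces.linear (*s) (*s) E"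
    unfolding N_def M_def E_def
    by (intro vec.linear_compose_sub vec.linear_compose_scale_right f g vec.linear_id[unfolded id_def])+
  have N_line: "N v \<in> vec.span {r}" and M_line: "M v \<in> vec.span {r}" for v
    unfolding N_def M_def by (rule fb gc)+
  have E_line: "E v \<in> vec.span {r}" for v
    unfolding E_def by (intro vec.span_diff vec.span_scale N_line M_line)
  have off: "\<exists>s t. s * b + t * c = 1 \<and> s *s N v + t *s M v = 0" if v: "v \<notin> vec.span {r}" for v
  proof -
    obtain s t where st: "v = s *s f v + t *s g v" using H by blast
    then have eq: "(1 - s * b - t * c) *s v = s *s N v + t *s M v"
      by (simp add: N_def M_def vec_eq_iff algebra_simps)
    also have "\<dots> \<in> vec.span {r}" by (intro vec.span_add vec.span_scale N_line M_line)
    finally have "1 - s * b - t * c = 0"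
      using v vec.span_scale[of "(1 - s * b - t * c) *s v" "{r}" "1 / (1 - s * b - t * c)"]
      by (metis (no_types, lifting) divide_self_if times_divide_eq_left mult_1 vec.scale_one vec.scale_scale)
    then show ?thesis using eq by (intro exI[of _ s] exI[of _ t]) (simp add: algebra_simps)
  qed
  have ker_off: "N v = 0 \<and> M v = 0" if v: "v \<notin> vec.span {r}" and Ev: "E v = 0" for v
  proof -
    obtain s t where st: "s * b + t * c = 1" "s *s N v + t *s M v = 0" using off[OF v] by blast
    have "N v $ i = 0 \<and> M v $ i = 0" for i
    proof -
      have "s * N v $ i + t * M v $ i = 0" "c * N v $ i = b * M v $ i"
        using st(2) Ev by (simp_all add: E_def vec_eq_iff)
      with st(1) show ?thesis by algebra
    qed
    then show ?thesis by (simp add: vec_eq_iff)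
  qed
  \<comment> \<open>the kernel of \<open>E\<close> has codimension at most one, hence is not inside the line\<close>
  obtain z where z: "z \<notin> vec.span {r}" "E z = 0"
  proof -
    obtain z1 where z1: "z1 \<notin> vec.span {r}" using exists_notin_plane[OF n, of r r] by auto
    show thesis
    proof (cases "E z1 = 0")
      case False
      obtain z2 where z2: "z2 \<notin> vec.span {r, z1}" using exists_notin_plane[OF n] by blast
      obtain a1 where a1: "E z1 = a1 *s r" using E_line by (rule span_singletonE)
      obtain a2 where a2: "E z2 = a2 *s r" using E_line by (rule span_singletonE)
      have "E (z2 - (a2 / a1) *s z1) = 0" using False a1 a2 by (auto simp: linear_vecD[OF NME(3)])
      moreover have "z2 - (a2 / a1) *s z1 \<notin> vec.span {r}"
      proof
        assume "z2 - (a2 / a1) *s z1 \<in> vec.span {r}"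
        then have "(z2 - (a2 / a1) *s z1) + (a2 / a1) *s z1 \<in> vec.span {r, z1}"
          using vec.span_mono[of "{r}" "{r, z1}"]
          by (intro vec.span_add vec.span_scale) (auto intro: vec.span_base)
        then show False using z2 by simp
      qed
      ultimately show thesis using that by blast
    qed (use z1 that in blast)
  qed
  \<comment> \<open>on the line itself, translate by \<open>z\<close>\<close>
  have ker: "N v = 0 \<and> M v = 0" if Ev: "E v = 0" for v
  proof (cases "v \<in> vec.span {r}")
    case True
    then have "v + z \<notin> vec.span {r}" using z(1) by (metis vec.span_diff add_diff_cancel_left')
    moreover have "E (v + z) = 0" using Ev z(2) by (simp add: linear_vecD[OF NME(3)])
    ultimately show ?thesis using ker_off ker_off[OF z]
      by (metis NME(1,2) linear_vecD(1) add.right_neutral)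
  qed (use ker_off Ev in blast)
  obtain k where k: "\<And>v. N v = k *s E v"
    using proportional_on_line[OF NME(1,3) N_line E_line] ker by blast
  obtain l where l: "\<And>v. M v = l *s E v"
    using proportional_on_line[OF NME(2,3) M_line E_line] ker by blast
  obtain s t where st: "s * b + t * c = 1" using off[OF z(1)] by blast
  have "v = (s - (s * k + t * l) * c) *s f v + (t + (s * k + t * l) * b) *s g v" for v
    unfolding vec_eq_iff
  proof
    fix i
    have "f v $ i - b * v $ i = k * (c * (f v $ i - b * v $ i) - b * (g v $ i - c * v $ i))"
         "g v $ i - c * v $ i = l * (c * (f v $ i - b * v $ i) - b * (g v $ i - c * v $ i))"
      using arg_cong[OF k, of "\<lambda>x. x $ i" v] arg_cong[OF l, of "\<lambda>x. x $ i" v]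
      by (simp_all only: N_def M_def E_def vector_smult_component vector_minus_component)
    with st show "v $ i = ((s - (s * k + t * l) * c) *s f v + (t + (s * k + t * l) * b) *s g v) $ i"
      unfolding vector_add_component vector_smult_component by algebra
  qed
  then show ?thesis by blast
qed

text \<open>
  A combination \<open>e = \<alpha> (f - 1) + \<beta> g\<close> with values in a line lets one eliminate one of the two maps
  modulo that line. For \<open>\<alpha> = 0\<close>, the map \<open>g\<close> itself has values in the line, and the hypothesis makes
  every vector an eigenvector of \<open>f\<close> modulo the line. For \<open>\<alpha> \<noteq> 0\<close>, substituting for \<open>f\<close> makes every
  vector outside the kernel of \<open>e\<close> an eigenvector of \<open>g\<close> modulo the line. In both cases \<open>f\<close> and \<open>g\<close>
  are scalar modulo the line.
\<close>

lemma identity_in_span_of_combination_mod_line: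
  fixes f g :: "'a::alg_closed_field ^ 'n \<Rightarrow> 'a ^ 'n"
  assumes n: "CARD('n) \<ge> 3"
    and f: "Vector_Spaces.linear (*s) (*s) f" and g: "Vector_Spaces.linear (*s) (*s) g"
    and H: "\<And>v. \<exists>s t. v = s *s f v + t *s g v"
    and nz: "\<alpha> \<noteq> 0 \<or> \<beta> \<noteq> 0"
    and line: "\<And>v. \<alpha> *s (f v - v) + \<beta> *s g v \<in> vec.span {r}"
  shows "\<exists>s t. \<forall>v. v = s *s f v + t *s g v"
proof (cases "\<alpha> = 0")
  case True
  have g_line: "g v \<in> vec.span {r}" for v
    using vec.span_scale[OF line, of "1 / \<beta>" v] True nz by simp
  obtain u :: "'a ^ 'n" where u: "u \<noteq> 0"
    using exists_notin_plane[OF n, of 0 0] vec.span_zero by metis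
  have "\<exists>\<gamma> \<delta>. (\<gamma> \<noteq> 0 \<or> \<delta> \<noteq> 0) \<and> \<gamma> *s v + \<delta> *s f v \<in> vec.span {r}" for v
  proof -
    obtain s t where "v = s *s f v + t *s g v" using H by blast
    then have "1 *s v + (- s) *s f v = t *s g v" by (simp add: algebra_simps)
    then have "1 *s v + (- s) *s f v \<in> vec.span {r}" using g_line by (simp only: vec.span_scale)
    then show ?thesis by (metis zero_neq_one)
  qed
  then obtain l where "\<And>v. f v - l *s v \<in> vec.span {r}"
    using scalar_mod_line[OF n f vec.linear_id[unfolded id_def] u] by metis
  then show ?thesis
    by (rule identity_in_span_mod_line[OF n f g H, of l r 0]) (simp add: g_line)
next
  case False
  define e where "e v = \<alpha> *s (f v - v) + \<beta> *s g v" for v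
  have e: "Vector_Spaces.linear (*s) (*s) e" unfolding e_def
    by (intro vec.linear_compose_add vec.linear_compose_scale_right vec.linear_compose_sub f g
        vec.linear_id[unfolded id_def])
  have fe: "f v = v + (1 / \<alpha>) *s e v - (\<beta> / \<alpha>) *s g v" for v
    using False by (simp add: e_def vec_eq_iff field_simps)
  show ?thesis
  proof (cases "\<forall>v. e v = 0")
    case True
    then have "v = 1 *s f v + (\<beta> / \<alpha>) *s g v" for v by (simp add: fe)
    then show ?thesis by blast
  next
    case False
    then obtain u where u: "e u \<noteq> 0" by blast
    have "\<exists>\<gamma> \<delta>. (\<gamma> \<noteq> 0 \<or> \<delta> \<noteq> 0) \<and> \<gamma> *s v + \<delta> *s g v \<in> vec.span {r}" if ev: "e v \<noteq> 0" for v
    proof -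
      obtain s t where st: "v = s *s f v + t *s g v" using H by blast
      have "(1 - s) *s v + (s * (\<beta> / \<alpha>) - t) *s g v = (s / \<alpha>) *s e v + (v - (s *s f v + t *s g v))"
        by (simp add: fe vec_eq_iff algebra_simps)
      then have eq: "(1 - s) *s v + (s * (\<beta> / \<alpha>) - t) *s g v = (s / \<alpha>) *s e v"
        by (simp only: st[symmetric] diff_self add_0_right)
      then have "(1 - s) *s v + (s * (\<beta> / \<alpha>) - t) *s g v \<in> vec.span {r}"
        using line by (simp only: e_def vec.span_scale)
      moreover have "1 - s \<noteq> 0 \<or> s * (\<beta> / \<alpha>) - t \<noteq> 0"
        using eq ev \<open>\<alpha> \<noteq> 0\<close> by auto
      ultimately show ?thesis by blast
    qed
    then obtain l where l: "\<And>v. g v - l *s v \<in> vec.span {r}"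
      using scalar_mod_line[OF n g e u] by metis
    show ?thesis
    proof (rule identity_in_span_mod_line[OF n f g H])
      fix v
      have "f v - (1 - (\<beta> / \<alpha>) * l) *s v = (1 / \<alpha>) *s e v - (\<beta> / \<alpha>) *s (g v - l *s v)"
        by (simp add: fe vec_eq_iff algebra_simps)
      also have "\<dots> \<in> vec.span {r}"
        unfolding e_def by (intro vec.span_diff[OF vec.span_scale[OF line] vec.span_scale[OF l]])
      finally show "f v - (1 - (\<beta> / \<alpha>) * l) *s v \<in> vec.span {r}" .
    qed (rule l)
  qed
qed

text \<open>
  For \<open>v\<close> outside the plane, the component of \<open>v = s (f v) + t (g v)\<close> modulo the plane yields \<open>s = 1\<close>,
  so \<open>f v - v\<close> is a multiple of \<open>g v\<close>. By density the two are parallel everywhere, and the dichotomy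
  leaves two cases that are already settled, with the lines of \<open>0\<close> and of \<open>r\<close>.
\<close>

lemma identity_in_span_mod_plane:
  fixes f g :: "'a::alg_closed_field ^ 'n \<Rightarrow> 'a ^ 'n"
  assumes n: "CARD('n) \<ge> 3"
    and f: "Vector_Spaces.linear (*s) (*s) f" and g: "Vector_Spaces.linear (*s) (*s) g"
    and H: "\<And>v. \<exists>s t. v = s *s f v + t *s g v"
    and f_plane: "\<And>v. f v - v \<in> vec.span {a, b}" and g_plane: "\<And>v. g v \<in> vec.span {a, b}"
  shows "\<exists>s t. \<forall>v. v = s *s f v + t *s g v"
proof -
  obtain z where "z \<notin> vec.span {a, b}" using exists_notin_plane[OF n] by blast
  then obtain e :: "'a ^ 'n \<Rightarrow> 'a ^ 'n" where e: "Vector_Spaces.linear (*s) (*s) e"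
    and e_plane: "\<And>v. v \<in> vec.span {a, b} \<Longrightarrow> e v = 0" and ez: "e z \<noteq> 0"
    by (rule linear_map_separating) blast
  have D: "Vector_Spaces.linear (*s) (*s) (\<lambda>v. f v - v)"
    by (intro vec.linear_compose_sub f vec.linear_id[unfolded id_def])
  have "parallel (f v - v) (g v)" for v
  proof (rule parallel_off_hyperplane[OF D g e ez])
    fix v assume ev: "e v \<noteq> 0"
    obtain s t where "v = s *s f v + t *s g v" using H by blast
    then have eq: "(1 - s) *s v = s *s (f v - v) + t *s g v"
      by (simp add: vec_eq_iff algebra_simps)
    also have "\<dots> \<in> vec.span {a, b}" by (intro vec.span_add vec.span_scale f_plane g_plane)
    finally have "(1 - s) *s e v = 0" using e_plane by (metis linear_vecD(3)[OF e])
    then have "s = 1" using ev by (metis vec.scale_eq_0_iff right_minus_eq)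
    then have "1 *s (f v - v) + t *s g v = 0" using eq by simp
    then show "parallel (f v - v) (g v)"
      unfolding parallel_iff_dependent by (metis zero_neq_one)
  qed
  then show ?thesis
  proof (rule pointwise_parallel_cases[OF D g])
    fix \<alpha> \<beta> assume nz: "\<alpha> \<noteq> 0 \<or> \<beta> \<noteq> 0" and "\<And>v. \<alpha> *s (f v - v) + \<beta> *s g v = 0"
    then have "\<alpha> *s (f v - v) + \<beta> *s g v \<in> vec.span {0}" for v by (metis vec.span_zero)
    then show ?thesis by (rule identity_in_span_of_combination_mod_line[OF n f g H nz])
  next
    fix r assume "\<And>v. f v - v \<in> vec.span {r}" "\<And>v. g v \<in> vec.span {r}"
    then show ?thesis using identity_in_span_mod_line[OF n f g H, of 1 r 0] by simp
  qed
qed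

text \<open>
  If \<open>D v\<close> and \<open>g v\<close> were independent modulo \<open>x0\<close>, the hypothesis at \<open>x0 + t v\<close> would place this
  vector into the plane of \<open>D v\<close> and \<open>g v\<close> for each \<open>t \<noteq> 0\<close>. Two such values of \<open>t\<close> would place
  \<open>x0\<close> itself there, a dependence modulo \<open>x0\<close>.
\<close>

lemma dependent_mod_kernel_vector:
  fixes D g :: "'a::alg_closed_field ^ 'n \<Rightarrow> 'a ^ 'n"
  assumes D: "Vector_Spaces.linear (*s) (*s) D" and g: "Vector_Spaces.linear (*s) (*s) g"
    and H: "\<And>v. \<exists>s t. v = s *s (v + D v) + t *s g v"
    and x0: "x0 \<noteq> 0" "D x0 = 0" "g x0 = 0"
  shows "\<exists>\<alpha> \<beta>. (\<alpha> \<noteq> 0 \<or> \<beta> \<noteq> 0) \<and> \<alpha> *s D v + \<beta> *s g v \<in> vec.span {x0}"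
proof (rule ccontr)
  assume "\<nexists>\<alpha> \<beta>. (\<alpha> \<noteq> 0 \<or> \<beta> \<noteq> 0) \<and> \<alpha> *s D v + \<beta> *s g v \<in> vec.span {x0}"
  then have contra: "\<alpha> = 0 \<and> \<beta> = 0" if "\<alpha> *s D v + \<beta> *s g v \<in> vec.span {x0}" for \<alpha> \<beta>
    using that by blast
  let ?P = "vec.span {D v, g v}"
  have plane: "a *s D v + b *s g v \<in> ?P" for a b
    by (intro vec.span_add vec.span_scale vec.span_base) auto
  have line: "x0 + t *s v \<in> ?P" if t: "t \<noteq> 0" for t
  proof -
    obtain s r where "x0 + t *s v = s *s (x0 + t *s v + D (x0 + t *s v)) + r *s g (x0 + t *s v)"
      using H by blast
    then have eq: "(1 - s) *s (x0 + t *s v) = t *s (s *s D v + r *s g v)"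
      by (simp add: linear_vecD[OF D] linear_vecD[OF g] x0 vec_eq_iff algebra_simps)
    show ?thesis
    proof (cases "s = 1")
      case True
      then have "t *s (s *s D v + r *s g v) = 0"
        using eq by (simp only: diff_self vec.scale_zero_left)
      then have "s *s D v + r *s g v = 0" using t by (metis vec.scale_eq_0_iff)
      then show ?thesis using contra[of s r] True by (simp add: vec.span_zero)
    next
      case False
      then have "x0 + t *s v = (1 / (1 - s)) *s ((1 - s) *s (x0 + t *s v))"
        by (simp only: vec.scale_scale) simp
      also have "\<dots> \<in> ?P" unfolding eq by (intro vec.span_scale plane)
      finally show ?thesis .
    qed
  qed
  \<comment> \<open>the polynomial \<open>1 - X + X\<^sup>2\<close> has value \<open>1\<close> at \<open>0\<close> and at \<open>1\<close>, so a root differs from both\<close>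
  obtain t :: 'a where "poly [:1, - 1, 1:] t = 0"
    using alg_closed_imp_poly_has_root[of "[:1, - 1, 1 :: 'a:]"] by auto
  then have t: "t \<noteq> 0" "t \<noteq> 1" by auto
  have "(1 / (t - 1)) *s (t *s (x0 + 1 *s v) - (x0 + t *s v)) \<in> ?P"
    using t(1) by (intro vec.span_scale vec.span_diff line) auto
  moreover have "(1 / (t - 1)) *s (t *s (x0 + 1 *s v) - (x0 + t *s v)) = x0"
    using t(2) by (simp add: vec_eq_iff divide_simps) (simp add: algebra_simps)
  ultimately have "x0 \<in> ?P" by simp
  then obtain a b where ab: "x0 = a *s D v + b *s g v"
  proof -
    obtain a where "x0 - a *s D v \<in> vec.span {g v}"
      using \<open>x0 \<in> ?P\<close> unfolding vec.span_insert[of "D v"] by blast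
    then obtain b where "x0 - a *s D v = b *s g v" by (rule span_singletonE)
    then show thesis using that[of a b] by (simp add: algebra_simps)
  qed
  then have "a = 0 \<and> b = 0" by (intro contra) (metis vec.span_base singletonI)
  then show False using ab x0 by simp
qed

text \<open>
  After the projection along \<open>x0\<close>, the maps \<open>f - 1\<close> and \<open>g\<close> are pointwise parallel. The two
  outcomes of the dichotomy are a combination with values in the line of \<open>x0\<close>, and a common plane
  spanned by \<open>x0\<close> and a further vector.
\<close>

lemma identity_in_span_of_singular:
  fixes f g :: "'a::alg_closed_field ^ 'n \<Rightarrow> 'a ^ 'n"
  assumes n: "CARD('n) \<ge> 3"
    and f: "Vector_Spaces.linear (*s) (*s) f" and g: "Vector_Spaces.linear (*s) (*s) g"
    and H: "\<And>v. \<exists>s t. v = s *s f v + t *s g v"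
    and x0: "x0 \<noteq> 0" "f x0 = x0" "g x0 = 0"
  shows "\<exists>s t. \<forall>v. v = s *s f v + t *s g v"
proof -
  have D: "Vector_Spaces.linear (*s) (*s) (\<lambda>v. f v - v)"
    by (intro vec.linear_compose_sub f vec.linear_id[unfolded id_def])
  obtain q :: "'a ^ 'n \<Rightarrow> 'a ^ 'n" where q: "Vector_Spaces.linear (*s) (*s) q"
    and vq: "\<And>v. v - q v \<in> vec.span {x0}" and qx0: "q x0 = 0"
    using projection_along[of x0] by metis
  have q0: "q v = 0" if "v \<in> vec.span {x0}" for v
    using that by (auto elim!: span_singletonE simp: linear_vecD[OF q] qx0)
  have f_split: "v + (f v - v) = f v" for v by simp
  have HD: "\<exists>s t. v = s *s (v + (f v - v)) + t *s g v" for v unfolding f_split by (rule H)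
  have Dx0: "f x0 - x0 = 0" using x0(2) by simp
  have par: "parallel (q (f v - v)) (q (g v))" for v
  proof -
    obtain \<alpha> \<beta> where nz: "\<alpha> \<noteq> 0 \<or> \<beta> \<noteq> 0" and mem: "\<alpha> *s (f v - v) + \<beta> *s g v \<in> vec.span {x0}"
      using dependent_mod_kernel_vector[OF D g HD x0(1) Dx0 x0(3)] by blast
    have "\<alpha> *s q (f v - v) + \<beta> *s q (g v) = 0"
      using q0[OF mem] by (simp only: linear_vecD(1,3)[OF q])
    then show ?thesis using nz unfolding parallel_iff_dependent by blast
  qed
  show ?thesis
  proof (rule pointwise_parallel_cases[OF linear_comp[OF D q] linear_comp[OF g q] par])
    fix \<alpha> \<beta> assume nz: "\<alpha> \<noteq> 0 \<or> \<beta> \<noteq> 0" and rel: "\<And>v. \<alpha> *s q (f v - v) + \<beta> *s q (g v) = 0"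
    have "q (\<alpha> *s (f v - v) + \<beta> *s g v) = 0" for v
      using rel[of v] by (simp only: linear_vecD(1,3)[OF q])
    then have "\<alpha> *s (f v - v) + \<beta> *s g v \<in> vec.span {x0}" for v
      by (metis vq diff_zero)
    then show ?thesis by (rule identity_in_span_of_combination_mod_line[OF n f g H nz])
  next
    fix p assume Dp: "\<And>v. q (f v - v) \<in> vec.span {p}" and gp: "\<And>v. q (g v) \<in> vec.span {p}"
    have lift: "w \<in> vec.span {x0, p}" if "q w \<in> vec.span {p}" for w
    proof -
      have "(w - q w) + q w \<in> vec.span {x0, p}"
        using vq[of w] that vec.span_mono[of "{x0}" "{x0, p}"] vec.span_mono[of "{p}" "{x0, p}"]
        by (intro vec.span_add) auto
      then show ?thesis by simp
    qed
    show ?thesis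
      by (rule identity_in_span_mod_plane[OF n f g H lift[OF Dp] lift[OF gp]])
  qed
qed

text \<open>
  A root of \<open>p(t) = det (B + t C)\<close> gives a singular member. If \<open>p\<close> is a constant \<open>c\<close>, then
  \<open>det (C + t B) = t\<^sup>n p(1/t) = c t\<^sup>n\<close> for \<open>t \<noteq> 0\<close>, hence also for \<open>t = 0\<close>, and \<open>C\<close> is singular.
\<close>

lemma singular_in_pencil:
  fixes B C :: "'a::alg_closed_field ^ 'n ^ 'n"
  obtains s t x where "s \<noteq> 0 \<or> t \<noteq> 0" "x \<noteq> 0" "s *s (B *v x) + t *s (C *v x) = 0"
proof -
  have kernel: "\<exists>x. x \<noteq> 0 \<and> A *v x = 0" if "det A = 0" for A :: "'a ^ 'n ^ 'n"
    using that matrix_left_invertible_ker[of A] invertible_left_inverse[of A] invertible_det_nz[of A]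
    by blast
  define p where "p = det (\<chi> i j. [:B $ i $ j, C $ i $ j:])"
  have p: "poly p t = det (B + mat_scale t C)" for t
    by (simp add: p_def det_def poly_sum poly_prod poly_mult mat_scale_def)
  show thesis
  proof (cases "degree p = 0")
    case False
    then obtain t where "poly p t = 0" using alg_closed_imp_poly_has_root by blast
    then obtain x where x: "x \<noteq> 0" "(B + mat_scale t C) *v x = 0" using kernel p by metis
    have "1 *s (B *v x) + t *s (C *v x) = (B + mat_scale t C) *v x"
      by (simp add: vec_eq_iff matrix_vector_mult_def mat_scale_def sum_distrib_left
          sum.distrib algebra_simps)
    with x show thesis using that[of 1 t x] by simp
  next
    case True
    then obtain c where c: "p = [:c:]" by (rule degree_eq_zeroE)
    define r where "r = det (\<chi> i j. [:C $ i $ j, B $ i $ j:]) - monom c CARD('n)"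
    have "poly r t = 0" if t: "t \<noteq> 0" for t
    proof -
      have "det (\<chi> i j. C $ i $ j + t * B $ i $ j) = det (\<chi> i. t *s (B + mat_scale (1 / t) C) $ i)"
        using t by (intro arg_cong[of _ _ det]) (simp add: vec_eq_iff mat_scale_def algebra_simps)
      also have "\<dots> = t ^ CARD('n) * det (B + mat_scale (1 / t) C)"
        by (subst det_rows_mul) (simp add: vec_nth_inverse)
      also have "\<dots> = t ^ CARD('n) * c" using p[of "1 / t"] c by simp
      finally show ?thesis
        by (simp add: r_def det_def poly_sum poly_prod poly_monom)
    qed
    then have "poly r 0 = 0" by (rule alg_closed_poly_zero_at_0)
    then have "det C = 0"
      by (simp add: r_def det_def poly_sum poly_prod poly_monom)
    then obtain x where "x \<noteq> 0" "C *v x = 0" using kernel by blast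
    then show thesis using that[of 0 1 x] by simp
  qed
qed

text \<open>
  A change of basis of the pencil that starts from a singular member reduces the claim to the case of
  a common eigenvector with eigenvalues \<open>1\<close> and \<open>0\<close>. The auxiliary statement treats a singular member
  that involves \<open>g\<close>; otherwise the two maps exchange their roles.
\<close>

lemma identity_in_span_of_two:
  fixes f g :: "'a::alg_closed_field ^ 'n \<Rightarrow> 'a ^ 'n"
  assumes n: "CARD('n) \<ge> 3"
    and f: "Vector_Spaces.linear (*s) (*s) f" and g: "Vector_Spaces.linear (*s) (*s) g"
    and H: "\<And>v. \<exists>s t. v = s *s f v + t *s g v"
  shows "\<exists>s t. \<forall>v. v = s *s f v + t *s g v"
proof -
  have singular: "\<exists>s t. \<forall>v. v = s *s f v + t *s g v"
    if f: "Vector_Spaces.linear (*s) (*s) f" and g: "Vector_Spaces.linear (*s) (*s) g"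
      and H: "\<And>v. \<exists>s t. v = s *s f v + t *s g v"
      and b: "b \<noteq> 0" and x: "x \<noteq> 0" "a *s f x + b *s g x = 0"
    for f g :: "'a ^ 'n \<Rightarrow> 'a ^ 'n" and a b x
  proof -
    define h where "h v = a *s f v + b *s g v" for v
    have h: "Vector_Spaces.linear (*s) (*s) h" unfolding h_def by (rule linear_combI[OF f g])
    have gh: "g v = (1 / b) *s h v - (a / b) *s f v" for v
      using b by (simp add: h_def vec_eq_iff field_simps)
    \<comment> \<open>at the kernel vector of \<open>h\<close> the hypothesis only involves \<open>f\<close>, so \<open>x\<close> is an eigenvector of \<open>f\<close>\<close>
    have hx: "h x = 0" using x(2) by (simp add: h_def)
    then have gx: "g x = (- (a / b)) *s f x" by (simp add: gh)
    obtain s t where "x = s *s f x + t *s g x" using H by blast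
    also have "\<dots> = (s - t * a / b) *s f x"
      unfolding gx by (simp add: vec_eq_iff algebra_simps)
    finally obtain c where c: "x = c *s f x" by blast
    then have c0: "c \<noteq> 0" using x(1) by auto
    define k where "k v = c *s f v" for v
    have k: "Vector_Spaces.linear (*s) (*s) k"
      unfolding k_def by (intro vec.linear_compose_scale_right f)
    have conv: "s *s f v + t *s g v = ((s - t * a / b) / c) *s k v + (t / b) *s h v" for s t v
      using c0 by (simp add: gh k_def vec_eq_iff field_simps)
    have "\<exists>s t. \<forall>v. v = s *s k v + t *s h v"
      using H unfolding conv
      by (intro identity_in_span_of_singular[OF n k h _ x(1)]) (metis, simp_all add: k_def hx c[symmetric])
    then obtain s t where st: "\<And>v. v = s *s k v + t *s h v" by blast
    have kh: "s *s k v + t *s h v = (s * c + t * a) *s f v + (t * b) *s g v" for v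
      by (simp add: h_def k_def vec_eq_iff algebra_simps)
    have "v = (s * c + t * a) *s f v + (t * b) *s g v" for v
      by (rule trans[OF st kh])
    then show ?thesis by blast
  qed
  obtain a b x where ab: "a \<noteq> 0 \<or> b \<noteq> 0" and x: "x \<noteq> 0" "a *s f x + b *s g x = 0"
    using singular_in_pencil[of "matrix f" "matrix g"] by (auto simp: matrix_works f g)
  show ?thesis
  proof (cases "b = 0")
    case False
    then show ?thesis using singular[OF f g H _ x] by blast
  next
    case True
    have "\<exists>s t. \<forall>v. v = s *s g v + t *s f v"
      using H ab True x by (intro singular[OF g f, of a x b]) (metis add.commute, auto simp: add.commute)
    then show ?thesis by (metis add.commute)
  qed
qed

section \<open>Subspaces of small codimension\<close>

text \<open>
  The trace form is nondegenerate: the matrix that represents a linear form collects its values at the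
  matrix units, transposed.
\<close>

lemma linear_form_mat_unit_expansion:
  fixes F :: "'a::field ^ 'n ^ 'n \<Rightarrow> 'a"
  assumes F: "Vector_Spaces.linear mat_scale (*) F"
  shows "F A = trace (A ** (\<chi> j i. F (mat_unit i j)))"
proof -
  interpret F: Vector_Spaces.linear mat_scale "(*)" F by (rule F)
  have "A = (\<Sum>p\<in>UNIV. mat_scale (A $ fst p $ snd p) (case p of (k, l) \<Rightarrow> mat_unit k l))"
    by (simp add: vec_eq_iff mat_unit_sum_nth del: sum_component)
  then have "F A = F (\<Sum>p\<in>UNIV. mat_scale (A $ fst p $ snd p) (case p of (k, l) \<Rightarrow> mat_unit k l))"
    by simp
  also have "\<dots> = (\<Sum>p\<in>UNIV. A $ fst p $ snd p * F (mat_unit (fst p) (snd p)))"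
    by (simp add: F.sum F.scale case_prod_beta)
  also have "\<dots> = (\<Sum>i\<in>UNIV. \<Sum>j\<in>UNIV. A $ i $ j * F (mat_unit i j))"
    by (simp add: sum.cartesian_product case_prod_beta)
  finally show ?thesis by (simp add: trace_def matrix_matrix_mult_def)
qed

text \<open>
  Extend a basis of \<open>W\<close> to the whole space. The coordinates along the one or two new vectors are the
  linear forms that cut out \<open>W\<close>; in codimension one the two forms coincide.
\<close>

lemma subspace_codim_1_or_2_eq:
  fixes W :: "('a::field ^ 'n ^ 'n) set"
  assumes W: "mat_vs.subspace W" and codim: "mat_codim W = 1 \<or> mat_codim W = 2"
  obtains B C where "W = {A. trace (A ** B) = 0 \<and> trace (A ** C) = 0}"
proof -
  obtain S where S: "S \<subseteq> W" "mat_vs.independent S" "W \<subseteq> mat_vs.span S" "card S = mat_vs.dim W"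
    by (rule mat_vs.basis_exists)
  have spanS: "mat_vs.span S = W"
    using S W mat_vs.span_minimal by blast
  let ?T = "mat_vs.extend_basis S"
  have T: "S \<subseteq> ?T" "mat_vs.independent ?T" "mat_vs.span ?T = UNIV"
    using mat_vs.extend_basis_superset mat_vs.independent_extend_basis mat_vs.span_extend_basis S(2)
    by blast+
  have finT: "finite ?T" using T(2) by (rule mat_vs.finiteI_independent)
  have "card ?T = mat_vs.dim (UNIV :: ('a ^ 'n ^ 'n) set)"
    using mat_vs.dim_span_eq_card_independent[OF T(2)] T(3) by simp
  then have "card (?T - S) = mat_codim W"
    using S(4) T(1) finT by (simp add: mat_codim_def card_Diff_subset finite_subset)
  then obtain U V where UV: "?T - S = {U, V}"
    using codim by (metis card_1_singletonE card_2_iff insert_absorb2)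
  let ?F = "\<lambda>X A. mat_vs.representation ?T A X"
  have lin: "Vector_Spaces.linear mat_scale (*) (?F X)" for X
    by (rule mat_vs.linear_representation[OF T(2,3)])
  have "A \<in> W \<longleftrightarrow> ?F U A = 0 \<and> ?F V A = 0" for A
  proof
    assume "A \<in> W"
    then have eq: "mat_vs.representation ?T A = mat_vs.representation S A"
      using spanS by (intro mat_vs.representation_extend[OF T(2) _ T(1)]) simp
    have "U \<notin> S" "V \<notin> S" using UV by blast+
    then show "?F U A = 0 \<and> ?F V A = 0"
      unfolding eq using mat_vs.representation_ne_zero by blast
  next
    assume UV0: "?F U A = 0 \<and> ?F V A = 0"
    have "A = (\<Sum>X\<in>?T. mat_scale (?F X A) X)"
      using T by (simp add: mat_vs.sum_representation_eq finT)
    also have "\<dots> = (\<Sum>X\<in>S. mat_scale (?F X A) X)"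
    proof (rule sum.mono_neutral_right[OF finT T(1)], rule ballI)
      fix X assume "X \<in> ?T - S"
      then have "?F X A = 0" using UV UV0 by auto
      then show "mat_scale (?F X A) X = 0" by simp
    qed
    also have "\<dots> \<in> W"
      using S(1) W by (intro mat_vs.subspace_sum mat_vs.subspace_scale) auto
    finally show "A \<in> W" .
  qed
  moreover have "?F X A = trace (A ** (\<chi> j i. ?F X (mat_unit i j)))" for X A
    by (rule linear_form_mat_unit_expansion[OF lin])
  ultimately have "A \<in> W \<longleftrightarrow> trace (A ** (\<chi> j i. ?F U (mat_unit i j))) = 0
      \<and> trace (A ** (\<chi> j i. ?F V (mat_unit i j))) = 0" for A
    by (metis (no_types))
  then show thesis by (intro that) blast
qed

definition outer :: "'a::field ^ 'n \<Rightarrow> 'a ^ 'n \<Rightarrow> 'a ^ 'n ^ 'n"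
  where "outer x y = (\<chi> i j. x $ i * y $ j)"

lemma rank_outer:
  assumes "x \<noteq> 0" "y \<noteq> 0"
  shows "rank (outer x y) = 1"
proof -
  have row: "row i (outer x y) = x $ i *s y" for i
    by (simp add: row_def outer_def vec_eq_iff)
  obtain k where k: "x $ k \<noteq> 0" using \<open>x \<noteq> 0\<close> by (auto simp: vec_eq_iff)
  have "rows (outer x y) \<subseteq> vec.span {y}"
    by (auto simp: rows_def row vec.span_scale vec.span_base)
  moreover have "y \<in> vec.span (rows (outer x y))"
  proof -
    have "(1 / x $ k) *s row k (outer x y) \<in> vec.span (rows (outer x y))"
      by (intro vec.span_scale vec.span_base) (auto simp: rows_def)
    then show ?thesis using k by (simp add: row)
  qed
  ultimately have "vec.span {y} = vec.span (rows (outer x y))"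
    by (simp add: vec.span_eq vec.span_base)
  then have "vec.dim (rows (outer x y)) = card {y}"
    using \<open>y \<noteq> 0\<close> by (intro vec.dim_eq_card) auto
  then show ?thesis by (simp add: row_rank_def_gen)
qed

lemma outer_idempotent:
  assumes "(\<Sum>i\<in>UNIV. y $ i * x $ i) = 1"
  shows "outer x y ** outer x y = outer x y"
proof -
  have "(\<Sum>k\<in>UNIV. x $ i * y $ k * (x $ k * y $ j)) = x $ i * y $ j * (\<Sum>k\<in>UNIV. y $ k * x $ k)" for i j
    unfolding sum_distrib_left by (rule sum.cong) (simp_all add: mult_ac)
  then show ?thesis using assms by (simp add: vec_eq_iff matrix_matrix_mult_def outer_def)
qed

lemma trace_outer_mult:
  "trace (outer x y ** B) = (\<Sum>j\<in>UNIV. y $ j * (B *v x) $ j)"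
  unfolding trace_def matrix_matrix_mult_def matrix_vector_mult_def outer_def
  by (simp add: sum_distrib_left, subst sum.swap) (simp add: mult_ac)

text \<open>
  A covector that separates \<open>x\<close> from the span of \<open>B x\<close> and \<open>C x\<close> would give a rank one idempotent
  \<open>outer x y\<close> in the subspace.
\<close>

lemma r1_free_imp_in_span:
  fixes B C :: "'a::field ^ 'n ^ 'n"
  assumes "r1_free {A. trace (A ** B) = 0 \<and> trace (A ** C) = 0}"
  shows "\<exists>s t. x = s *s (B *v x) + t *s (C *v x)"
proof -
  have "x \<in> vec.span {B *v x, C *v x}"
  proof (rule ccontr)
    assume "x \<notin> vec.span {B *v x, C *v x}"
    then obtain y where y: "(\<Sum>i\<in>UNIV. y $ i * x $ i) = 1"
      "\<And>v. v \<in> {B *v x, C *v x} \<Longrightarrow> (\<Sum>i\<in>UNIV. y $ i * v $ i) = 0"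
      by (rule separating_covector) blast
    then have "x \<noteq> 0" "y \<noteq> 0" by auto
    then have "rank (outer x y) = 1" by (rule rank_outer)
    moreover have "outer x y ** outer x y = outer x y" using y(1) by (rule outer_idempotent)
    moreover have "trace (outer x y ** B) = 0" "trace (outer x y ** C) = 0"
      using y(2) by (simp_all add: trace_outer_mult)
    ultimately show False using assms by (auto simp: r1_free_def)
  qed
  then obtain s where "x - s *s (B *v x) \<in> vec.span {C *v x}"
    unfolding vec.span_insert[of "B *v x"] by blast
  then obtain t where "x - s *s (B *v x) = t *s (C *v x)"
    by (auto simp: vec.span_singleton)
  then have "x = s *s (B *v x) + t *s (C *v x)" by (simp add: algebra_simps)
  then show ?thesis by blast
qed

lemma r1_free_codim_1_or_2_trace_0:
  fixes W :: "('a::alg_closed_field ^ 'n ^ 'n) set"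
  assumes n: "CARD('n) \<ge> 3"
    and W: "mat_vs.subspace W" "r1_free W" "mat_codim W = 1 \<or> mat_codim W = 2"
  shows "W \<subseteq> {A. trace A = 0}"
proof -
  obtain B C where WBC: "W = {A. trace (A ** B) = 0 \<and> trace (A ** C) = 0}"
    using subspace_codim_1_or_2_eq[OF W(1,3)] .
  have "\<exists>s t. v = s *s (B *v v) + t *s (C *v v)" for v
    using W(2) unfolding WBC by (rule r1_free_imp_in_span)
  then obtain s t where st: "\<And>v. v = s *s (B *v v) + t *s (C *v v)"
    using identity_in_span_of_two[OF n matrix_vector_mul_linear_gen matrix_vector_mul_linear_gen]
    by metis
  have tr: "trace A = s * trace (A ** B) + t * trace (A ** C)" for A
  proof -
    have "mat_scale s B + mat_scale t C = mat 1"
      unfolding matrix_eq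
    proof
      fix v
      have "(mat_scale s B + mat_scale t C) *v v = s *s (B *v v) + t *s (C *v v)"
        by (simp add: vec_eq_iff matrix_vector_mult_def mat_scale_def sum_distrib_left
            sum.distrib algebra_simps)
      then show "(mat_scale s B + mat_scale t C) *v v = mat 1 *v v" using st[of v] by simp
    qed
    then have "trace A = trace (A ** (mat_scale s B + mat_scale t C))" by simp
    also have "\<dots> = s * trace (A ** B) + t * trace (A ** C)"
      by (simp add: trace_def matrix_matrix_mult_def mat_scale_def sum_distrib_left
          sum.distrib algebra_simps)
    finally show ?thesis .
  qed
  show ?thesis
  proof
    fix A assume "A \<in> W"
    then have "trace (A ** B) = 0" "trace (A ** C) = 0" by (simp_all add: WBC)
    then show "A \<in> {A. trace A = 0}" unfolding mem_Collect_eq tr[of A] by simp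
  qed
qed

section \<open>Rank one idempotents and larger codimension\<close>

lemma rank_1_imp_outer:
  assumes "rank A = 1"
  obtains x y where "A = outer x y"
proof -
  obtain B where B: "rows A \<subseteq> vec.span B" "card B = vec.dim (rows A)"
    by (rule vec.basis_exists)
  then obtain y where "B = {y}"
    using assms by (auto simp: row_rank_def_gen card_1_singleton_iff)
  then have "\<exists>c. row i A = c *s y" for i
    using B(1) by (auto simp: rows_def vec.span_singleton)
  then obtain x where x: "\<And>i. row i A = x i *s y" by metis
  have "A = outer (\<chi> i. x i) y"
    using x by (simp add: outer_def row_def vec_eq_iff)
  then show thesis by (rule that)
qed

text \<open>
  For \<open>A = x y\<^sup>T\<close>, the square of \<open>A\<close> is \<open>tr A\<close> times \<open>A\<close>.
\<close>

lemma trace_rank_1_idempotent: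
  assumes "rank A = 1" and "A ** A = A"
  shows "trace A = 1"
proof -
  obtain x y where A: "A = outer x y" using assms(1) by (rule rank_1_imp_outer)
  have "A \<noteq> 0"
  proof
    assume "A = 0"
    then have "rows A \<subseteq> vec.span {}" by (auto simp: rows_def row_def vec_eq_iff)
    then have "vec.dim (rows A) \<le> card ({} :: ('a ^ 'b) set)" by (rule vec.dim_le_card) simp
    then show False using assms(1) unfolding row_rank_def_gen card.empty by linarith
  qed
  then obtain i j where ij: "A $ i $ j \<noteq> 0" by (auto simp: vec_eq_iff)
  have "(A ** A) $ i $ j = A $ i $ j * trace A"
    unfolding A matrix_matrix_mult_def outer_def trace_def
    by (simp add: sum_distrib_left mult_ac)
  then show ?thesis using assms(2) ij by simp
qed

text \<open>
  A vector of \<open>W\<close> outside the kernel spans \<open>W\<close> together with the kernel.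
\<close>

lemma (in finite_dimensional_vector_space) dim_le_Suc_dim_kernel:
  assumes W: "subspace W" and F: "Vector_Spaces.linear scale (*) F"
  shows "dim W \<le> Suc (dim (W \<inter> {x. F x = 0}))"
proof (cases "W \<subseteq> {x. F x = 0}")
  case True
  then show ?thesis by (simp add: Int_absorb2)
next
  case False
  interpret F: Vector_Spaces.linear scale "(*)" F by (rule F)
  obtain u where u: "u \<in> W" "F u \<noteq> 0" using False by auto
  have "W \<subseteq> span (insert u (W \<inter> {x. F x = 0}))"
  proof
    fix x assume x: "x \<in> W"
    have "x - scale (F x / F u) u \<in> W \<inter> {x. F x = 0}"
      using W u x by (simp add: subspace_diff subspace_scale F.diff F.scale)
    then show "x \<in> span (insert u (W \<inter> {x. F x = 0}))"
      unfolding span_insert by (blast intro: span_base)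
  qed
  then have "dim W \<le> dim (insert u (W \<inter> {x. F x = 0}))" by (rule dim_mono)
  also have "\<dots> \<le> Suc (dim (W \<inter> {x. F x = 0}))" by (simp add: dim_insert)
  finally show ?thesis .
qed

lemma (in finite_dimensional_vector_space) subspace_of_dim_containing:
  assumes W: "subspace W" and a: "a \<in> W" "a \<noteq> 0" and k: "1 \<le> k" "k \<le> dim W"
  obtains V where "subspace V" "V \<subseteq> W" "a \<in> V" "dim V = k"
proof -
  obtain B where B: "{a} \<subseteq> B" "B \<subseteq> W" "independent B" "W \<subseteq> span B"
    using a by (elim maximal_independent_subset_extend[of "{a}" W, rotated 2]) auto
  have "card B = dim W" by (rule basis_card_eq_dim[OF B(2,4,3)])
  then obtain T where T: "{a} \<subseteq> T" "T \<subseteq> B" "card T = k"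
    using exists_subset_between[of "{a}" k B] k B finiteI_independent by auto
  show thesis
  proof (rule that[of "span T"])
    show "span T \<subseteq> W" using T(2) B(2) W by (intro span_minimal) auto
    show "a \<in> span T" using T(1) by (simp add: span_base)
    show "dim (span T) = k"
      using T(2,3) B(3) by (simp add: dim_eq_card_independent independent_mono)
  qed simp
qed

lemma r1_free_subset: "r1_free W \<Longrightarrow> V \<subseteq> W \<Longrightarrow> r1_free V"
  by (auto simp: r1_free_def)

text \<open>
  The two-by-two minor at rows and columns \<open>i\<close>, \<open>j\<close> turns the three conditions into \<open>tr A = 0\<close> for
  rank one matrices, which excludes idempotents.
\<close>

lemma r1_free_codim_3_witness:
  fixes i j :: "'n::finite"
  shows "r1_free {A :: 'a::field ^ 'n ^ 'n.
           A $ i $ i = 0 \<and> A $ i $ j + A $ j $ i = 0 \<and> trace A + A $ j $ i = 0}"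
  unfolding r1_free_def
proof (clarify)
  fix A :: "'a ^ 'n ^ 'n"
  assume rank: "rank A = 1" and idem: "A ** A = A"
    and cond: "A $ i $ i = 0" "A $ i $ j + A $ j $ i = 0" "trace A + A $ j $ i = 0"
  obtain x y where "A = outer x y" using rank by (rule rank_1_imp_outer)
  then have "A $ i $ j * A $ j $ i = A $ i $ i * A $ j $ j" by (simp add: outer_def)
  then have "A $ j $ i * A $ j $ i = 0" using cond(1,2) by algebra
  then have "trace A = 0" using cond(3) by simp
  then show False using trace_rank_1_idempotent[OF rank idem] by simp
qed

text \<open>
  The three linear conditions above cut out a space \<open>K\<close> of codimension at most three. It contains a
  matrix \<open>Z\<close> of trace \<open>1\<close>, for which a third index \<open>k\<close> is needed. Any subspace of \<open>K\<close> through \<open>Z\<close>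
  inherits r1-freeness from \<open>K\<close> and nonzero trace from \<open>Z\<close>, and such subspaces exist in every
  dimension from \<open>1\<close> up to that of \<open>K\<close>.
\<close>

lemma subspace_r1_free_nonzero_trace:
  assumes n: "CARD('n::finite) \<ge> 3" and d: "3 \<le> d" "d < CARD('n)\<^sup>2"
  shows "\<exists>W :: ('a::field ^ 'n ^ 'n) set.
    mat_vs.subspace W \<and> r1_free W \<and> mat_codim W = d \<and> \<not> W \<subseteq> {A. trace A = 0}"
proof -
  obtain S :: "'n set" where "card S = 3" using obtain_subset_with_card_n[OF n] by blast
  then obtain i j k :: 'n where ijk: "i \<noteq> j" "j \<noteq> k" "i \<noteq> k" by (auto simp: card_3_iff)
  define F1 F2 F3 :: "'a ^ 'n ^ 'n \<Rightarrow> 'a" where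
    "F1 A = A $ i $ i" and "F2 A = A $ i $ j + A $ j $ i" and "F3 A = trace A + A $ j $ i" for A
  have lin: "Vector_Spaces.linear mat_scale (*) F1" "Vector_Spaces.linear mat_scale (*) F2"
    "Vector_Spaces.linear mat_scale (*) F3"
    unfolding F1_def F2_def F3_def Vector_Spaces.linear_iff
    by (simp_all add: mat_vs.vector_space_axioms vector_space_over_itself.vector_space_axioms
        mat_scale_def trace_def sum.distrib sum_distrib_left algebra_simps)
  have sub: "mat_vs.subspace {A. F A = 0}" if "Vector_Spaces.linear mat_scale (*) F"
    for F :: "'a ^ 'n ^ 'n \<Rightarrow> 'a"
  proof -
    interpret F: Vector_Spaces.linear mat_scale "(*)" F by (rule that)
    show ?thesis by (rule F.subspace_kernel)
  qed
  define K where "K = UNIV \<inter> {A. F1 A = 0} \<inter> {A. F2 A = 0} \<inter> {A. F3 A = 0}"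
  have K_sub: "mat_vs.subspace K"
    unfolding K_def by (intro mat_vs.subspace_inter sub lin mat_vs.subspace_UNIV)
  have "CARD('n)\<^sup>2 \<le> mat_vs.dim K + 3"
    unfolding K_def dim_mat_UNIV[symmetric, where 'a = 'a and 'n = 'n]
    using mat_vs.dim_le_Suc_dim_kernel[OF mat_vs.subspace_UNIV lin(1)]
      mat_vs.dim_le_Suc_dim_kernel[OF mat_vs.subspace_inter[OF mat_vs.subspace_UNIV sub[OF lin(1)]] lin(2)]
      mat_vs.dim_le_Suc_dim_kernel[OF mat_vs.subspace_inter[OF mat_vs.subspace_inter[OF
        mat_vs.subspace_UNIV sub[OF lin(1)]] sub[OF lin(2)]] lin(3)]
    by linarith
  then have dim: "1 \<le> CARD('n)\<^sup>2 - d" "CARD('n)\<^sup>2 - d \<le> mat_vs.dim K" using d by linarith+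
  define Z :: "'a ^ 'n ^ 'n" where "Z = mat_unit i j - mat_unit j i + mat_unit k k"
  have trZ: "trace Z = 1"
  proof -
    have "trace Z = (\<Sum>a\<in>UNIV. if a = k then 1 else 0)"
      unfolding trace_def by (rule sum.cong) (use ijk in \<open>auto simp: Z_def mat_unit_def\<close>)
    then show ?thesis by simp
  qed
  have "Z \<in> K" using ijk trZ by (simp add: K_def F1_def F2_def F3_def) (simp add: Z_def mat_unit_def)
  moreover have "Z \<noteq> 0" using trZ by (auto simp: trace_def)
  ultimately obtain W where W: "mat_vs.subspace W" "W \<subseteq> K" "Z \<in> W" "mat_vs.dim W = CARD('n)\<^sup>2 - d"
    using dim by (rule mat_vs.subspace_of_dim_containing[OF K_sub])
  show ?thesis
  proof (intro exI conjI)
    show "mat_vs.subspace W" by (rule W(1))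
    have "K \<subseteq> {A. A $ i $ i = 0 \<and> A $ i $ j + A $ j $ i = 0 \<and> trace A + A $ j $ i = 0}"
      by (auto simp: K_def F1_def F2_def F3_def)
    then show "r1_free W" using W(2) by (intro r1_free_subset[OF r1_free_codim_3_witness]) blast
    show "mat_codim W = d" unfolding mat_codim_def dim_mat_UNIV W(4) using d by simp
    show "\<not> W \<subseteq> {A. trace A = 0}" using W(3) trZ by auto
  qed
qed

theorem theorem10:
  assumes n_ge_3: "CARD('n::finite) \<ge> 3"
    and char_F: "CHAR('a::alg_closed_field) = 0 \<or> CHAR('a) > CARD('n)"
  shows "(\<forall>W :: ('a ^ 'n ^ 'n) set.
            mat_vs.subspace W \<and> r1_free W \<and> (mat_codim W = 1 \<or> mat_codim W = 2)
              \<longrightarrow> W \<subseteq> {A. trace A = 0})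
       \<and> (CARD('n) \<ge> 4 \<longrightarrow>
           (\<forall>d. 3 \<le> d \<and> d < CARD('n) \<longrightarrow>
             (\<exists>W :: ('a ^ 'n ^ 'n) set.
                mat_vs.subspace W \<and> r1_free W \<and> mat_codim W = d
                  \<and> \<not> W \<subseteq> {A. trace A = 0})))"
proof (intro conjI impI allI, elim conjE)
  fix W :: "('a ^ 'n ^ 'n) set"
  assume "mat_vs.subspace W" "r1_free W" "mat_codim W = 1 \<or> mat_codim W = 2"
  then show "W \<subseteq> {A. trace A = 0}" by (rule r1_free_codim_1_or_2_trace_0[OF n_ge_3])
next
  fix d assume "3 \<le> d \<and> d < CARD('n)"
  moreover have "CARD('n) * 1 \<le> CARD('n) * CARD('n)" using n_ge_3 by (intro mult_le_mono) linarith+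
  ultimately have "3 \<le> d" "d < CARD('n)\<^sup>2" unfolding power2_eq_square by linarith+
  then show "\<exists>W :: ('a ^ 'n ^ 'n) set. mat_vs.subspace W \<and> r1_free W \<and> mat_codim W = d
      \<and> \<not> W \<subseteq> {A. trace A = 0}"
    by (rule subspace_r1_free_nonzero_trace[OF n_ge_3])
qed

end
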